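(* Let $s \colon P\otimes C \to T \otimes C$ be a simulator in a target--context category, and let $r^* \colon s \to \mathrm{id}$ be a lax reduction from $s$ to the trivial simulator, i.e. $r \colon T \to P$ is a functional morphism with $s\circ (r\otimes \mathrm{id}_C) \succeq \mathrm{id}_{T\otimes C}$. Assume that $r^*$ is also an oplax reduction, i.e. that additionally $\mathrm{id}_{T\otimes C} \succeq s\circ (r\otimes \mathrm{id}_C)$ holds. If there exists a morphism $m \colon P \to T$ satisfying $$ s \circ \bigl((r\circ m)\otimes \mathrm{id}_C\bigr) = s, $$ then $s$ is more parsimonious than the trivial simulator, i.e. there exists a simulator morphism of type $\mathrm{id}_{T\otimes C} \to s$.
   Context: A target--context category $(\mathcal{C},T,C,\succeq)$ is a normalized gs-monoidal category $\mathcal{C}$ (symmetric monoidal, every object equipped with copy $\mathrm{copy}_A\colon A\to A\otimes A$ and delete $\mathrm{del}_A\colon A\to I$ forming a commutative comonoid compatible with $\otimes$, and every morphism $f$ satisfying $f\circ\mathrm{dom}(f)=f$, where $\mathrm{dom}(f)=(\mathrm{id}_A\otimes(\mathrm{del}_X\circ f))\circ\mathrm{copy}_A$), with distinguished objects $T$ (targets) and $C$ (contexts), and a preorder $\succeq$ (the ambient relation) on every hom-set $\mathcal{C}(A,T\otimes C)$ such that $f\circ\mathrm{dom}(g)=g$ implies $f\succeq g$, and $f\succeq g$ implies $f\circ h\succeq g\circ h$. A morphism $f$ is functional if $\mathrm{copy}_X\circ f=(f\otimes f)\circ\mathrm{copy}_A$. A simulator is a morphism $s\colon P\otimes C\to T\otimes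 C$ that splits as $s=(s_T\otimes s_C)\circ(\mathrm{copy}_P\otimes\mathrm{id}_C)$ with a functional compiler $s_T\colon P\to T$ and a context reduction $s_C\colon P\otimes C\to C$. The trivial simulator is $\mathrm{id}_{T\otimes C}$, with programs $P=T$. A reduction $r^*\colon s\to s'$ (for simulators with programs $P$, $P'$) is given by a functional $r\colon P'\to P$ with $s\circ(r\otimes\mathrm{id}_C)=s'$; it is lax (resp. oplax) if only $s\circ(r\otimes\mathrm{id}_C)\succeq s'$ (resp. $s'\succeq s\circ(r\otimes\mathrm{id}_C)$) holds. A processing $q_*\colon s\to s'$ between simulators with the same programs $P$ is a morphism $q\colon P\otimes T\otimes C\to T\otimes C$ which is itself a simulator with programs $P\otimes T$ (functional compiler $q_T$), satisfies $\mathrm{del}_P\otimes\mathrm{id}_{T\otimes C}\succeq q$, and satisfies $s'=q\circ(\mathrm{id}_P\otimes s)\circ(\mathrm{copy}_P\otimes\mathrm{id}_C)$. A simulator morphism $s\to s'$ is a pair $(r^*,q_* )$ of a reduction $r^*\colon s\to r^*s$ followed by a processing $q_*\colon r^*s\to s'$. For universal simulators $s,s'$, one says $s'$ is more parsimonious than $s$ if there exists a simulator morphism $s\to s'$.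
   Formalization: The morphism m : P → T is additionally assumed to be functional; for an arbitrary morphism m the claim is false (there is a counterexample in sets and relations), since a reduction must be given by a functional morphism. *)

theory Defs
  imports Main
begin

section \<open>Symmetric monoidal categories\<close>

record ('o, 'm) category_data =
  Obj :: "'o set"
  Arr :: "'m set"
  src :: "'m \<Rightarrow> 'o"
  tgt :: "'m \<Rightarrow> 'o"
  ident :: "'o \<Rightarrow> 'm" ("\<i>\<d>\<index>")
  cmp :: "'m \<Rightarrow> 'm \<Rightarrow> 'm"  (infixr "\<cdot>\<index>" 55)

definition hom :: "('o, 'm, 'z) category_data_scheme \<Rightarrow> 'o \<Rightarrow> 'o \<Rightarrow> 'm set"
  where "hom \<C> A B = {f \<in> Arr \<C>. src \<C> f = A \<and> tgt \<C> f = B}"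

locale category =
  fixes \<C> :: "('o, 'm, 'z) category_data_scheme" (structure)
  assumes src_obj: "f \<in> Arr \<C> \<Longrightarrow> src \<C> f \<in> Obj \<C>"
    and tgt_obj: "f \<in> Arr \<C> \<Longrightarrow> tgt \<C> f \<in> Obj \<C>"
    and ident_hom: "A \<in> Obj \<C> \<Longrightarrow> \<i>\<d> A \<in> hom \<C> A A"
    and cmp_hom: "\<lbrakk>f \<in> hom \<C> A B; g \<in> hom \<C> B D\<rbrakk> \<Longrightarrow> g \<cdot> f \<in> hom \<C> A D"
    and cmp_assoc: "\<lbrakk>f \<in> hom \<C> A B; g \<in> hom \<C> B D; h \<in> hom \<C> D E\<rbrakk>
      \<Longrightarrow> (h \<cdot> g) \<cdot> f = h \<cdot> (g \<cdot> f)"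
    and ident_left: "f \<in> hom \<C> A B \<Longrightarrow> \<i>\<d> B \<cdot> f = f"
    and ident_right: "f \<in> hom \<C> A B \<Longrightarrow> f \<cdot> \<i>\<d> A = f"

definition inverse_arrows :: "('o, 'm, 'z) category_data_scheme \<Rightarrow> 'o \<Rightarrow> 'o \<Rightarrow> 'm \<Rightarrow> 'm \<Rightarrow> bool"
  where "inverse_arrows \<C> A B f g \<longleftrightarrow>
    f \<in> hom \<C> A B \<and> g \<in> hom \<C> B A \<and>
    g \<cdot>\<^bsub>\<C>\<^esub> f = \<i>\<d>\<^bsub>\<C>\<^esub> A \<and> f \<cdot>\<^bsub>\<C>\<^esub> g = \<i>\<d>\<^bsub>\<C>\<^esub> B"

text \<open>
  Objects and arrows have separate tensor products \<open>\<otimes>\<close> and \<open>\<boxtimes>\<close>. Strictness is not assumed: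
  \<open>assc A B D : (A \<otimes> B) \<otimes> D \<rightarrow> A \<otimes> (B \<otimes> D)\<close>, \<open>lunit A : I \<otimes> A \<rightarrow> A\<close>, \<open>runit A : A \<otimes> I \<rightarrow> A\<close>,
  and \<open>assc'\<close> is the inverse of \<open>assc\<close>.
\<close>

record ('o, 'm) monoidal_data = "('o, 'm) category_data" +
  tensor_obj :: "'o \<Rightarrow> 'o \<Rightarrow> 'o"  (infixr "\<otimes>\<index>" 70)
  tensor_arr :: "'m \<Rightarrow> 'm \<Rightarrow> 'm"  (infixr "\<boxtimes>\<index>" 70)
  unit_obj :: "'o"  ("\<I>\<index>")
  assc :: "'o \<Rightarrow> 'o \<Rightarrow> 'o \<Rightarrow> 'm"
  assc' :: "'o \<Rightarrow> 'o \<Rightarrow> 'o \<Rightarrow> 'm"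
  lunit :: "'o \<Rightarrow> 'm"
  runit :: "'o \<Rightarrow> 'm"
  braid :: "'o \<Rightarrow> 'o \<Rightarrow> 'm"

locale symmetric_monoidal_category = category \<C>
  for \<C> :: "('o, 'm, 'z) monoidal_data_scheme" (structure) +
  assumes tensor_obj_closed: "\<lbrakk>A \<in> Obj \<C>; B \<in> Obj \<C>\<rbrakk> \<Longrightarrow> A \<otimes> B \<in> Obj \<C>"
    and unit_obj_closed: "\<I> \<in> Obj \<C>"
    and tensor_hom: "\<lbrakk>f \<in> hom \<C> A B; f' \<in> hom \<C> A' B'\<rbrakk>
      \<Longrightarrow> f \<boxtimes> f' \<in> hom \<C> (A \<otimes> A') (B \<otimes> B')"
    and tensor_ident: "\<lbrakk>A \<in> Obj \<C>; B \<in> Obj \<C>\<rbrakk> \<Longrightarrow> \<i>\<d> A \<boxtimes> \<i>\<d> B = \<i>\<d> (A \<otimes> B)"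
    and interchange:
      "\<lbrakk>f \<in> hom \<C> A B; g \<in> hom \<C> B D; f' \<in> hom \<C> A' B'; g' \<in> hom \<C> B' D'\<rbrakk>
        \<Longrightarrow> (g \<cdot> f) \<boxtimes> (g' \<cdot> f') = (g \<boxtimes> g') \<cdot> (f \<boxtimes> f')"
    and assc_iso: "\<lbrakk>A \<in> Obj \<C>; B \<in> Obj \<C>; D \<in> Obj \<C>\<rbrakk>
      \<Longrightarrow> inverse_arrows \<C> ((A \<otimes> B) \<otimes> D) (A \<otimes> (B \<otimes> D)) (assc \<C> A B D) (assc' \<C> A B D)"
    and lunit_iso: "A \<in> Obj \<C> \<Longrightarrow> \<exists>g. inverse_arrows \<C> (\<I> \<otimes> A) A (lunit \<C> A) g"
    and runit_iso: "A \<in> Obj \<C> \<Longrightarrow> \<exists>g. inverse_arrows \<C> (A \<otimes> \<I>) A (runit \<C> A) g"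
    and braid_iso: "\<lbrakk>A \<in> Obj \<C>; B \<in> Obj \<C>\<rbrakk>
      \<Longrightarrow> inverse_arrows \<C> (A \<otimes> B) (B \<otimes> A) (braid \<C> A B) (braid \<C> B A)"
    and assc_natural:
      "\<lbrakk>f \<in> hom \<C> A A'; g \<in> hom \<C> B B'; h \<in> hom \<C> D D'\<rbrakk>
        \<Longrightarrow> assc \<C> A' B' D' \<cdot> ((f \<boxtimes> g) \<boxtimes> h) = (f \<boxtimes> (g \<boxtimes> h)) \<cdot> assc \<C> A B D"
    and lunit_natural: "f \<in> hom \<C> A B \<Longrightarrow> lunit \<C> B \<cdot> (\<i>\<d> \<I> \<boxtimes> f) = f \<cdot> lunit \<C> A"
    and runit_natural: "f \<in> hom \<C> A B \<Longrightarrow> runit \<C> B \<cdot> (f \<boxtimes> \<i>\<d> \<I>) = f \<cdot> runit \<C> A"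
    and braid_natural: "\<lbrakk>f \<in> hom \<C> A A'; g \<in> hom \<C> B B'\<rbrakk>
      \<Longrightarrow> braid \<C> A' B' \<cdot> (f \<boxtimes> g) = (g \<boxtimes> f) \<cdot> braid \<C> A B"
    and pentagon: "\<lbrakk>A \<in> Obj \<C>; B \<in> Obj \<C>; D \<in> Obj \<C>; E \<in> Obj \<C>\<rbrakk>
      \<Longrightarrow> assc \<C> A B (D \<otimes> E) \<cdot> assc \<C> (A \<otimes> B) D E =
          (\<i>\<d> A \<boxtimes> assc \<C> B D E) \<cdot> assc \<C> A (B \<otimes> D) E \<cdot> (assc \<C> A B D \<boxtimes> \<i>\<d> E)"
    and triangle: "\<lbrakk>A \<in> Obj \<C>; B \<in> Obj \<C>\<rbrakk>
      \<Longrightarrow> (\<i>\<d> A \<boxtimes> lunit \<C> B) \<cdot> assc \<C> A \<I> B = runit \<C> A \<boxtimes> \<i>\<d> B"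
    and hexagon: "\<lbrakk>A \<in> Obj \<C>; B \<in> Obj \<C>; D \<in> Obj \<C>\<rbrakk>
      \<Longrightarrow> assc \<C> B D A \<cdot> braid \<C> A (B \<otimes> D) \<cdot> assc \<C> A B D =
          (\<i>\<d> B \<boxtimes> braid \<C> A D) \<cdot> assc \<C> B A D \<cdot> (braid \<C> A B \<boxtimes> \<i>\<d> D)"
    and braid_unit: "A \<in> Obj \<C> \<Longrightarrow> lunit \<C> A \<cdot> braid \<C> A \<I> = runit \<C> A"


section \<open>Normalized gs-monoidal categories\<close>

record ('o, 'm) gs_monoidal_data = "('o, 'm) monoidal_data" +
  cpy :: "'o \<Rightarrow> 'm"
  del :: "'o \<Rightarrow> 'm"

text \<open>The canonical isomorphism \<open>(A \<otimes> A) \<otimes> (B \<otimes> B) \<rightarrow> (A \<otimes> B) \<otimes> (A \<otimes> B)\<close> swapping the two middle factors.\<close>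

definition middle_swap :: "('o, 'm, 'z) monoidal_data_scheme \<Rightarrow> 'o \<Rightarrow> 'o \<Rightarrow> 'm"
  where "middle_swap \<C> A B =
    assc' \<C> A B (A \<otimes>\<^bsub>\<C>\<^esub> B) \<cdot>\<^bsub>\<C>\<^esub>
    (\<i>\<d>\<^bsub>\<C>\<^esub> A \<boxtimes>\<^bsub>\<C>\<^esub>
      (assc \<C> B A B \<cdot>\<^bsub>\<C>\<^esub> (braid \<C> A B \<boxtimes>\<^bsub>\<C>\<^esub> \<i>\<d>\<^bsub>\<C>\<^esub> B) \<cdot>\<^bsub>\<C>\<^esub> assc' \<C> A B B)) \<cdot>\<^bsub>\<C>\<^esub>
    assc \<C> A A (B \<otimes>\<^bsub>\<C>\<^esub> B)"

locale gs_monoidal_category = symmetric_monoidal_category \<C>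
  for \<C> :: "('o, 'm, 'z) gs_monoidal_data_scheme" (structure) +
  assumes cpy_hom: "A \<in> Obj \<C> \<Longrightarrow> cpy \<C> A \<in> hom \<C> A (A \<otimes> A)"
    and del_hom: "A \<in> Obj \<C> \<Longrightarrow> del \<C> A \<in> hom \<C> A \<I>"
    and cpy_coassoc: "A \<in> Obj \<C>
      \<Longrightarrow> assc \<C> A A A \<cdot> (cpy \<C> A \<boxtimes> \<i>\<d> A) \<cdot> cpy \<C> A = (\<i>\<d> A \<boxtimes> cpy \<C> A) \<cdot> cpy \<C> A"
    and cpy_counit_left: "A \<in> Obj \<C> \<Longrightarrow> lunit \<C> A \<cdot> (del \<C> A \<boxtimes> \<i>\<d> A) \<cdot> cpy \<C> A = \<i>\<d> A"
    and cpy_counit_right: "A \<in> Obj \<C> \<Longrightarrow> runit \<C> A \<cdot> (\<i>\<d> A \<boxtimes> del \<C> A) \<cdot> cpy \<C> A = \<i>\<d> A"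
    and cpy_commute: "A \<in> Obj \<C> \<Longrightarrow> braid \<C> A A \<cdot> cpy \<C> A = cpy \<C> A"
    and cpy_tensor: "\<lbrakk>A \<in> Obj \<C>; B \<in> Obj \<C>\<rbrakk>
      \<Longrightarrow> cpy \<C> (A \<otimes> B) = middle_swap \<C> A B \<cdot> (cpy \<C> A \<boxtimes> cpy \<C> B)"
    and del_tensor: "\<lbrakk>A \<in> Obj \<C>; B \<in> Obj \<C>\<rbrakk>
      \<Longrightarrow> del \<C> (A \<otimes> B) = lunit \<C> \<I> \<cdot> (del \<C> A \<boxtimes> del \<C> B)"
    and cpy_unit: "lunit \<C> \<I> \<cdot> cpy \<C> \<I> = \<i>\<d> \<I>"
    and del_unit: "del \<C> \<I> = \<i>\<d> \<I>"

definition domain_of :: "('o, 'm, 'z) gs_monoidal_data_scheme \<Rightarrow> 'm \<Rightarrow> 'm"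
  where "domain_of \<C> f =
    runit \<C> (src \<C> f) \<cdot>\<^bsub>\<C>\<^esub>
    (\<i>\<d>\<^bsub>\<C>\<^esub> (src \<C> f) \<boxtimes>\<^bsub>\<C>\<^esub> (del \<C> (tgt \<C> f) \<cdot>\<^bsub>\<C>\<^esub> f)) \<cdot>\<^bsub>\<C>\<^esub> cpy \<C> (src \<C> f)"

locale normalized_gs_monoidal_category = gs_monoidal_category \<C>
  for \<C> :: "('o, 'm, 'z) gs_monoidal_data_scheme" (structure) +
  assumes normalized: "f \<in> Arr \<C> \<Longrightarrow> f \<cdot> domain_of \<C> f = f"

definition functional :: "('o, 'm, 'z) gs_monoidal_data_scheme \<Rightarrow> 'm \<Rightarrow> bool"
  where "functional \<C> f \<longleftrightarrow> f \<in> Arr \<C> \<and>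
    cpy \<C> (tgt \<C> f) \<cdot>\<^bsub>\<C>\<^esub> f = (f \<boxtimes>\<^bsub>\<C>\<^esub> f) \<cdot>\<^bsub>\<C>\<^esub> cpy \<C> (src \<C> f)"


section \<open>Target--context categories\<close>

record ('o, 'm) target_context_data = "('o, 'm) gs_monoidal_data" +
  target :: "'o"  ("\<T>\<index>")
  context_obj :: "'o"  ("\<K>\<index>")
  ambient :: "'m \<Rightarrow> 'm \<Rightarrow> bool"  (infix "\<succeq>\<index>" 50)

text \<open>
  An arrow determines its source and target, so a single relation carries the preorders on all the
  hom-sets into \<open>\<T> \<otimes> \<K>\<close>.
\<close>

locale target_context_category = normalized_gs_monoidal_category \<C>
  for \<C> :: "('o, 'm, 'z) target_context_data_scheme" (structure) +
  assumes target_obj: "\<T> \<in> Obj \<C>"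
    and context_obj_obj: "\<K> \<in> Obj \<C>"
    and ambient_refl: "f \<in> hom \<C> A (\<T> \<otimes> \<K>) \<Longrightarrow> f \<succeq> f"
    and ambient_trans:
      "\<lbrakk>f \<in> hom \<C> A (\<T> \<otimes> \<K>); g \<in> hom \<C> A (\<T> \<otimes> \<K>); h \<in> hom \<C> A (\<T> \<otimes> \<K>); f \<succeq> g; g \<succeq> h\<rbrakk>
        \<Longrightarrow> f \<succeq> h"
    and ambient_restrict:
      "\<lbrakk>f \<in> hom \<C> A (\<T> \<otimes> \<K>); g \<in> hom \<C> A (\<T> \<otimes> \<K>); f \<cdot> domain_of \<C> g = g\<rbrakk> \<Longrightarrow> f \<succeq> g"
    and ambient_precomp:
      "\<lbrakk>f \<in> hom \<C> A (\<T> \<otimes> \<K>); g \<in> hom \<C> A (\<T> \<otimes> \<K>); h \<in> hom \<C> B A; f \<succeq> g\<rbrakk>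
        \<Longrightarrow> f \<cdot> h \<succeq> g \<cdot> h"


section \<open>Simulators and their morphisms\<close>

definition simulator :: "('o, 'm, 'z) target_context_data_scheme \<Rightarrow> 'o \<Rightarrow> 'm \<Rightarrow> bool"
  where "simulator \<C> P s \<longleftrightarrow>
    P \<in> Obj \<C> \<and> s \<in> hom \<C> (P \<otimes>\<^bsub>\<C>\<^esub> \<K>\<^bsub>\<C>\<^esub>) (\<T>\<^bsub>\<C>\<^esub> \<otimes>\<^bsub>\<C>\<^esub> \<K>\<^bsub>\<C>\<^esub>) \<and>
    (\<exists>s\<^sub>T \<in> hom \<C> P \<T>\<^bsub>\<C>\<^esub>. \<exists>s\<^sub>C \<in> hom \<C> (P \<otimes>\<^bsub>\<C>\<^esub> \<K>\<^bsub>\<C>\<^esub>) \<K>\<^bsub>\<C>\<^esub>.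
      functional \<C> s\<^sub>T \<and>
      s = (s\<^sub>T \<boxtimes>\<^bsub>\<C>\<^esub> s\<^sub>C) \<cdot>\<^bsub>\<C>\<^esub> assc \<C> P P \<K>\<^bsub>\<C>\<^esub> \<cdot>\<^bsub>\<C>\<^esub> (cpy \<C> P \<boxtimes>\<^bsub>\<C>\<^esub> \<i>\<d>\<^bsub>\<C>\<^esub> \<K>\<^bsub>\<C>\<^esub>))"

definition trivial_simulator :: "('o, 'm, 'z) target_context_data_scheme \<Rightarrow> 'm"
  where "trivial_simulator \<C> = \<i>\<d>\<^bsub>\<C>\<^esub> (\<T>\<^bsub>\<C>\<^esub> \<otimes>\<^bsub>\<C>\<^esub> \<K>\<^bsub>\<C>\<^esub>)"

definition pull :: "('o, 'm, 'z) target_context_data_scheme \<Rightarrow> 'm \<Rightarrow> 'm \<Rightarrow> 'm"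
  where "pull \<C> r s = s \<cdot>\<^bsub>\<C>\<^esub> (r \<boxtimes>\<^bsub>\<C>\<^esub> \<i>\<d>\<^bsub>\<C>\<^esub> \<K>\<^bsub>\<C>\<^esub>)"

text \<open>
  In the next three definitions \<open>r : P' \<rightarrow> P\<close> gives an (ordinary, lax, oplax) reduction from the
  simulator \<open>s\<close> with programs \<open>P\<close> to the simulator \<open>s'\<close> with programs \<open>P'\<close>.
\<close>

definition reduction ::
  "('o, 'm, 'z) target_context_data_scheme \<Rightarrow> 'o \<Rightarrow> 'm \<Rightarrow> 'o \<Rightarrow> 'm \<Rightarrow> 'm \<Rightarrow> bool"
  where "reduction \<C> P s P' s' r \<longleftrightarrow> simulator \<C> P s \<and> simulator \<C> P' s' \<and>
    r \<in> hom \<C> P' P \<and> functional \<C> r \<and> pull \<C> r s = s'"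

definition lax_reduction ::
  "('o, 'm, 'z) target_context_data_scheme \<Rightarrow> 'o \<Rightarrow> 'm \<Rightarrow> 'o \<Rightarrow> 'm \<Rightarrow> 'm \<Rightarrow> bool"
  where "lax_reduction \<C> P s P' s' r \<longleftrightarrow> simulator \<C> P s \<and> simulator \<C> P' s' \<and>
    r \<in> hom \<C> P' P \<and> functional \<C> r \<and> pull \<C> r s \<succeq>\<^bsub>\<C>\<^esub> s'"

definition oplax_reduction ::
  "('o, 'm, 'z) target_context_data_scheme \<Rightarrow> 'o \<Rightarrow> 'm \<Rightarrow> 'o \<Rightarrow> 'm \<Rightarrow> 'm \<Rightarrow> bool"
  where "oplax_reduction \<C> P s P' s' r \<longleftrightarrow> simulator \<C> P s \<and> simulator \<C> P' s' \<and>
    r \<in> hom \<C> P' P \<and> functional \<C> r \<and> s' \<succeq>\<^bsub>\<C>\<^esub> pull \<C> r s"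

text \<open>
  A processing is bracketed as \<open>q : (P \<otimes> \<T>) \<otimes> \<K> \<rightarrow> \<T> \<otimes> \<K>\<close>, so that it is literally a simulator with
  programs \<open>P \<otimes> \<T>\<close>.
\<close>

definition processing ::
  "('o, 'm, 'z) target_context_data_scheme \<Rightarrow> 'o \<Rightarrow> 'm \<Rightarrow> 'm \<Rightarrow> 'm \<Rightarrow> bool"
  where "processing \<C> P s s' q \<longleftrightarrow> simulator \<C> P s \<and> simulator \<C> P s' \<and>
    simulator \<C> (P \<otimes>\<^bsub>\<C>\<^esub> \<T>\<^bsub>\<C>\<^esub>) q \<and>
    lunit \<C> (\<T>\<^bsub>\<C>\<^esub> \<otimes>\<^bsub>\<C>\<^esub> \<K>\<^bsub>\<C>\<^esub>) \<cdot>\<^bsub>\<C>\<^esub> (del \<C> P \<boxtimes>\<^bsub>\<C>\<^esub> \<i>\<d>\<^bsub>\<C>\<^esub> (\<T>\<^bsub>\<C>\<^esub> \<otimes>\<^bsub>\<C>\<^esub> \<K>\<^bsub>\<C>\<^esub>)) \<cdot>\<^bsub>\<C>\<^esub>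
      assc \<C> P \<T>\<^bsub>\<C>\<^esub> \<K>\<^bsub>\<C>\<^esub> \<succeq>\<^bsub>\<C>\<^esub> q \<and>
    s' = q \<cdot>\<^bsub>\<C>\<^esub> assc' \<C> P \<T>\<^bsub>\<C>\<^esub> \<K>\<^bsub>\<C>\<^esub> \<cdot>\<^bsub>\<C>\<^esub> (\<i>\<d>\<^bsub>\<C>\<^esub> P \<boxtimes>\<^bsub>\<C>\<^esub> s) \<cdot>\<^bsub>\<C>\<^esub>
      assc \<C> P P \<K>\<^bsub>\<C>\<^esub> \<cdot>\<^bsub>\<C>\<^esub> (cpy \<C> P \<boxtimes>\<^bsub>\<C>\<^esub> \<i>\<d>\<^bsub>\<C>\<^esub> \<K>\<^bsub>\<C>\<^esub>)"

definition simulator_morphism ::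
  "('o, 'm, 'z) target_context_data_scheme \<Rightarrow> 'o \<Rightarrow> 'm \<Rightarrow> 'o \<Rightarrow> 'm \<Rightarrow> 'm \<Rightarrow> 'm \<Rightarrow> bool"
  where "simulator_morphism \<C> P s P' s' r q \<longleftrightarrow>
    reduction \<C> P s P' (pull \<C> r s) r \<and> processing \<C> P' (pull \<C> r s) s' q"

text \<open>\<open>more_parsimonious \<C> P' s' P s\<close>: the simulator \<open>s'\<close> is more parsimonious than \<open>s\<close>.\<close>

definition more_parsimonious ::
  "('o, 'm, 'z) target_context_data_scheme \<Rightarrow> 'o \<Rightarrow> 'm \<Rightarrow> 'o \<Rightarrow> 'm \<Rightarrow> bool"
  where "more_parsimonious \<C> P' s' P s \<longleftrightarrow> (\<exists>r q. simulator_morphism \<C> P s P' s' r q)"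

text \<open>
  Pitfall: an arrow \<open>m : P \<rightarrow> \<T>\<close> with \<open>s \<cdot> ((r \<cdot> m) \<boxtimes> \<i>\<d> \<K>) = s\<close> yields a reduction of the trivial simulator
  only if it is functional, and without this the trivial simulator need not have a morphism to \<open>s\<close>,
  even when \<open>r\<close> is both lax and oplax. In relations, take \<open>\<T> = \<K> = {0, 1}\<close>, \<open>P = {0, 1, 2}\<close>,
  \<open>r p = p\<close>, \<open>m p = {p}\<close> for \<open>p < 2\<close> and \<open>m 2 = {0, 1}\<close>; let \<open>s (p, c) = {(0, (c + p) mod 2)}\<close>
  for \<open>p < 2\<close> and \<open>s (2, c) = {(0, 0), (0, 1)}\<close>, and with \<open>e = s \<cdot> (r \<boxtimes> \<i>\<d> \<K>)\<close> let \<open>f \<succeq> g\<close> mean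
  \<open>e \<cdot> g \<subseteq> e \<cdot> f\<close>. Since \<open>e\<close> is an idempotent function, \<open>r\<close> is lax and oplax. A simulator morphism
  from the trivial simulator would be given by a functional \<open>r'\<close> and a \<open>q\<close> for which all of \<open>s (2, c)\<close>
  lies in \<open>q (2, r' 2, c)\<close>, while \<open>e \<cdot> q\<close> has at most one value there; but \<open>e\<close> separates the two
  elements of \<open>s (2, c)\<close>.
\<close>

end

theory Submission
  imports Defs
begin

text \<open>
  Let \<open>\<pi> : P \<otimes> \<T> \<rightarrow> \<T>\<close> discard the program. Reduce the trivial simulator along \<open>m\<close> and process with
  \<open>q = s \<cdot> ((r \<cdot> \<pi>) \<boxtimes> \<i>\<d> \<K>)\<close>. Precomposing \<open>id \<succeq> s \<cdot> (r \<boxtimes> id)\<close> with \<open>\<pi> \<boxtimes> id\<close> gives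
  \<open>\<pi> \<boxtimes> id \<succeq> q\<close>, and \<open>\<pi> \<cdot> (id \<boxtimes> m) \<cdot> copy = m\<close> turns the processed simulator into
  \<open>s \<cdot> ((r \<cdot> m) \<boxtimes> id) = s\<close>. As the monoidal structure is not strict, the work lies in the coherence
  isomorphisms, above all in showing that \<open>\<pi>\<close> is functional.
\<close>

section \<open>Typing and rewriting\<close>

lemma homD:
  assumes "f \<in> hom \<C> A B"
  shows "f \<in> Arr \<C>" "src \<C> f = A" "tgt \<C> f = B"
  using assms by (auto simp: hom_def)

text \<open>
  The laws are restated with composability expressed through \<open>src\<close> and \<open>tgt\<close>: the premises of the
  \<open>hom\<close> versions mention objects that the simplifier cannot guess.
\<close>

context category
begin

lemma homI: "\<lbrakk>f \<in> Arr \<C>; src \<C> f = A; tgt \<C> f = B\<rbrakk> \<Longrightarrow> f \<in> hom \<C> A B"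
  by (simp add: hom_def)

lemma ident_type [simp]:
  assumes "A \<in> Obj \<C>"
  shows "\<i>\<d> A \<in> Arr \<C>" "src \<C> (\<i>\<d> A) = A" "tgt \<C> (\<i>\<d> A) = A"
  using homD[OF ident_hom[OF assms]] by auto

lemma cmp_type [simp]:
  assumes "f \<in> Arr \<C>" "g \<in> Arr \<C>" "src \<C> g = tgt \<C> f"
  shows "g \<cdot> f \<in> Arr \<C>" "src \<C> (g \<cdot> f) = src \<C> f" "tgt \<C> (g \<cdot> f) = tgt \<C> g"
  using homD[OF cmp_hom[of f "src \<C> f" "tgt \<C> f" g "tgt \<C> g"]] assms by (auto simp: hom_def)

lemma arr_obj [simp]:
  assumes "f \<in> Arr \<C>"
  shows "src \<C> f \<in> Obj \<C>" "tgt \<C> f \<in> Obj \<C>"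
  using assms src_obj tgt_obj by auto

lemma assoc [simp]:
  assumes "f \<in> Arr \<C>" "g \<in> Arr \<C>" "h \<in> Arr \<C>" "src \<C> g = tgt \<C> f" "src \<C> h = tgt \<C> g"
  shows "(h \<cdot> g) \<cdot> f = h \<cdot> (g \<cdot> f)"
  using cmp_assoc[of f "src \<C> f" "tgt \<C> f" g "tgt \<C> g" h "tgt \<C> h"] assms by (auto simp: hom_def)

lemma ident_cmp [simp]:
  assumes "f \<in> Arr \<C>" "tgt \<C> f = B"
  shows "\<i>\<d> B \<cdot> f = f"
  using ident_left[of f "src \<C> f" B] assms by (auto simp: hom_def)

lemma cmp_ident [simp]:
  assumes "f \<in> Arr \<C>" "src \<C> f = A"
  shows "f \<cdot> \<i>\<d> A = f"
  using ident_right[of f A "tgt \<C> f"] assms by (auto simp: hom_def)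

text \<open>Isomorphisms are epimorphisms: compose with the inverse \<open>v\<close> on the right.
  This allows a coherence identity to be checked after precomposition with structural
  isomorphisms.\<close>

lemma cancel_iso_right:
  assumes "inverse_arrows \<C> A B u v" "f \<in> Arr \<C>" "g \<in> Arr \<C>" "src \<C> f = B" "src \<C> g = B"
    and "f \<cdot> u = g \<cdot> u"
  shows "f = g"
proof -
  have t: "u \<in> Arr \<C>" "v \<in> Arr \<C>" "src \<C> u = A" "tgt \<C> u = B" "src \<C> v = B" "tgt \<C> v = A"
    and uv: "u \<cdot> v = \<i>\<d> B"
    using assms(1) by (auto simp: inverse_arrows_def hom_def)
  have "f = f \<cdot> u \<cdot> v" using assms t uv by simp
  also have "\<dots> = (f \<cdot> u) \<cdot> v" using assms(2-5) t by simp
  also have "\<dots> = g \<cdot> u \<cdot> v" using assms t by simp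
  finally show ?thesis using assms t uv by simp
qed

end

section \<open>Coherence\<close>

context symmetric_monoidal_category
begin

lemma unit_obj [simp]: "\<I> \<in> Obj \<C>"
  by (rule unit_obj_closed)

lemma tensor_obj [simp]: "\<lbrakk>A \<in> Obj \<C>; B \<in> Obj \<C>\<rbrakk> \<Longrightarrow> A \<otimes> B \<in> Obj \<C>"
  by (rule tensor_obj_closed)

lemma tensor_type [simp]:
  assumes "f \<in> Arr \<C>" "g \<in> Arr \<C>"
  shows "f \<boxtimes> g \<in> Arr \<C>" "src \<C> (f \<boxtimes> g) = src \<C> f \<otimes> src \<C> g" "tgt \<C> (f \<boxtimes> g) = tgt \<C> f \<otimes> tgt \<C> g"
  using homD[OF tensor_hom[of f "src \<C> f" "tgt \<C> f" g "src \<C> g" "tgt \<C> g"]] assms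
  by (auto simp: hom_def)

lemma tensor_ident_simp [simp]:
  "\<lbrakk>A \<in> Obj \<C>; B \<in> Obj \<C>\<rbrakk> \<Longrightarrow> \<i>\<d> A \<boxtimes> \<i>\<d> B = \<i>\<d> (A \<otimes> B)"
  by (rule tensor_ident)

lemma tensor_cmp:
  assumes "f \<in> Arr \<C>" "g \<in> Arr \<C>" "f' \<in> Arr \<C>" "g' \<in> Arr \<C>" "src \<C> g = tgt \<C> f" "src \<C> g' = tgt \<C> f'"
  shows "(g \<boxtimes> g') \<cdot> (f \<boxtimes> f') = (g \<cdot> f) \<boxtimes> (g' \<cdot> f')"
  using interchange[of f "src \<C> f" "tgt \<C> f" g "tgt \<C> g" f' "src \<C> f'" "tgt \<C> f'" g' "tgt \<C> g'"] assms
  by (auto simp: hom_def)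

text \<open>Since \<open>assoc\<close> nests composites to the right, a pair to be fused is usually
  followed by a tail \<open>k\<close>, which \<open>tensor_cmp\<close> does not match. The
  \<open>_cmp\<close> variants of the naturality and inverse laws serve the same purpose.\<close>

lemma tensor_cmp_cmp:
  assumes "f \<in> Arr \<C>" "g \<in> Arr \<C>" "f' \<in> Arr \<C>" "g' \<in> Arr \<C>" "src \<C> g = tgt \<C> f" "src \<C> g' = tgt \<C> f'"
    and "k \<in> Arr \<C>" "tgt \<C> k = src \<C> f \<otimes> src \<C> f'"
  shows "(g \<boxtimes> g') \<cdot> (f \<boxtimes> f') \<cdot> k = ((g \<cdot> f) \<boxtimes> (g' \<cdot> f')) \<cdot> k"
  using assms by (simp flip: tensor_cmp assoc)

lemma assc_type [simp]:
  assumes "A \<in> Obj \<C>" "B \<in> Obj \<C>" "D \<in> Obj \<C>"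
  shows "assc \<C> A B D \<in> Arr \<C>" "src \<C> (assc \<C> A B D) = (A \<otimes> B) \<otimes> D"
    "tgt \<C> (assc \<C> A B D) = A \<otimes> (B \<otimes> D)"
    "assc' \<C> A B D \<in> Arr \<C>" "src \<C> (assc' \<C> A B D) = A \<otimes> (B \<otimes> D)"
    "tgt \<C> (assc' \<C> A B D) = (A \<otimes> B) \<otimes> D"
  using assc_iso[OF assms] by (auto simp: inverse_arrows_def hom_def)

lemma assc_inverse [simp]:
  assumes "A \<in> Obj \<C>" "B \<in> Obj \<C>" "D \<in> Obj \<C>"
  shows "assc' \<C> A B D \<cdot> assc \<C> A B D = \<i>\<d> ((A \<otimes> B) \<otimes> D)"
    "assc \<C> A B D \<cdot> assc' \<C> A B D = \<i>\<d> (A \<otimes> (B \<otimes> D))"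
  using assc_iso[OF assms] by (auto simp: inverse_arrows_def)

lemma assc_inverse_cmp [simp]:
  assumes "A \<in> Obj \<C>" "B \<in> Obj \<C>" "D \<in> Obj \<C>" "f \<in> Arr \<C>"
  shows "tgt \<C> f = (A \<otimes> B) \<otimes> D \<Longrightarrow> assc' \<C> A B D \<cdot> assc \<C> A B D \<cdot> f = f"
    "tgt \<C> f = A \<otimes> (B \<otimes> D) \<Longrightarrow> assc \<C> A B D \<cdot> assc' \<C> A B D \<cdot> f = f"
  using assms by (simp_all flip: assoc)

lemma unitor_type [simp]:
  assumes "A \<in> Obj \<C>"
  shows "lunit \<C> A \<in> Arr \<C>" "src \<C> (lunit \<C> A) = \<I> \<otimes> A" "tgt \<C> (lunit \<C> A) = A"
    "runit \<C> A \<in> Arr \<C>" "src \<C> (runit \<C> A) = A \<otimes> \<I>" "tgt \<C> (runit \<C> A) = A"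
  using lunit_iso[OF assms] runit_iso[OF assms] by (auto simp: inverse_arrows_def hom_def)

lemma braid_type [simp]:
  assumes "A \<in> Obj \<C>" "B \<in> Obj \<C>"
  shows "braid \<C> A B \<in> Arr \<C>" "src \<C> (braid \<C> A B) = A \<otimes> B" "tgt \<C> (braid \<C> A B) = B \<otimes> A"
  using braid_iso[OF assms] by (auto simp: inverse_arrows_def hom_def)

section \<open>Naturality of the structural isomorphisms\<close>

lemma assc_nat:
  assumes "f \<in> Arr \<C>" "g \<in> Arr \<C>" "h \<in> Arr \<C>"
    and "A = tgt \<C> f" "B = tgt \<C> g" "D = tgt \<C> h"
  shows "assc \<C> A B D \<cdot> ((f \<boxtimes> g) \<boxtimes> h) = (f \<boxtimes> (g \<boxtimes> h)) \<cdot> assc \<C> (src \<C> f) (src \<C> g) (src \<C> h)"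
  using assc_natural[of f _ _ g _ _ h] assms by (auto simp: hom_def)

lemma assc_nat_cmp:
  assumes "f \<in> Arr \<C>" "g \<in> Arr \<C>" "h \<in> Arr \<C>"
    and "A = tgt \<C> f" "B = tgt \<C> g" "D = tgt \<C> h"
    and "k \<in> Arr \<C>" "tgt \<C> k = (src \<C> f \<otimes> src \<C> g) \<otimes> src \<C> h"
  shows "assc \<C> A B D \<cdot> ((f \<boxtimes> g) \<boxtimes> h) \<cdot> k =
    (f \<boxtimes> (g \<boxtimes> h)) \<cdot> assc \<C> (src \<C> f) (src \<C> g) (src \<C> h) \<cdot> k"
  using assms assc_nat[OF assms(1-6)] by (simp flip: assoc)

text \<open>The naturality square of \<open>assc\<close> with its associators inverted: insert
  \<open>?a \<cdot> ?a'\<close> on the right, cross the square, and cancel on the left.\<close>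

lemma assc'_nat:
  assumes "f \<in> Arr \<C>" "g \<in> Arr \<C>" "h \<in> Arr \<C>"
    and "A = tgt \<C> f" "B = tgt \<C> g" "D = tgt \<C> h"
  shows "assc' \<C> A B D \<cdot> (f \<boxtimes> (g \<boxtimes> h)) = ((f \<boxtimes> g) \<boxtimes> h) \<cdot> assc' \<C> (src \<C> f) (src \<C> g) (src \<C> h)"
proof -
  let ?a = "assc \<C> (src \<C> f) (src \<C> g) (src \<C> h)"
  let ?a' = "assc' \<C> (src \<C> f) (src \<C> g) (src \<C> h)"
  have "assc' \<C> A B D \<cdot> (f \<boxtimes> (g \<boxtimes> h)) = assc' \<C> A B D \<cdot> (f \<boxtimes> (g \<boxtimes> h)) \<cdot> ?a \<cdot> ?a'"
    using assms by simp
  also have "\<dots> = assc' \<C> A B D \<cdot> assc \<C> A B D \<cdot> ((f \<boxtimes> g) \<boxtimes> h) \<cdot> ?a'"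
    using assms by (subst assc_nat_cmp) simp_all
  also have "\<dots> = ((f \<boxtimes> g) \<boxtimes> h) \<cdot> ?a'"
    using assms by simp
  finally show ?thesis .
qed

lemma assc'_nat_cmp:
  assumes "f \<in> Arr \<C>" "g \<in> Arr \<C>" "h \<in> Arr \<C>"
    and "A = tgt \<C> f" "B = tgt \<C> g" "D = tgt \<C> h"
    and "k \<in> Arr \<C>" "tgt \<C> k = src \<C> f \<otimes> (src \<C> g \<otimes> src \<C> h)"
  shows "assc' \<C> A B D \<cdot> (f \<boxtimes> (g \<boxtimes> h)) \<cdot> k =
    ((f \<boxtimes> g) \<boxtimes> h) \<cdot> assc' \<C> (src \<C> f) (src \<C> g) (src \<C> h) \<cdot> k"
  using assms assc'_nat[OF assms(1-6)] by (simp flip: assoc)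

lemma braid_nat:
  assumes "f \<in> Arr \<C>" "g \<in> Arr \<C>" "A = tgt \<C> f" "B = tgt \<C> g"
  shows "braid \<C> A B \<cdot> (f \<boxtimes> g) = (g \<boxtimes> f) \<cdot> braid \<C> (src \<C> f) (src \<C> g)"
  using braid_natural[of f _ _ g] assms by (auto simp: hom_def)

lemma lunit_nat: "f \<in> Arr \<C> \<Longrightarrow> lunit \<C> (tgt \<C> f) \<cdot> (\<i>\<d> \<I> \<boxtimes> f) = f \<cdot> lunit \<C> (src \<C> f)"
  using lunit_natural[of f] by (auto simp: hom_def)

lemma runit_nat: "f \<in> Arr \<C> \<Longrightarrow> runit \<C> (tgt \<C> f) \<cdot> (f \<boxtimes> \<i>\<d> \<I>) = f \<cdot> runit \<C> (src \<C> f)"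
  using runit_natural[of f] by (auto simp: hom_def)

text \<open>By naturality of \<open>lunit\<close>, the equal arrows
  \<open>\<i>\<d> \<I> \<boxtimes> f\<close> and \<open>\<i>\<d> \<I> \<boxtimes> g\<close> give
  \<open>f\<close> and \<open>g\<close> the same composite with the isomorphism
  \<open>lunit\<close>, which cancels.\<close>

lemma unit_tensor_faithful:
  assumes "f \<in> Arr \<C>" "g \<in> Arr \<C>" "src \<C> f = src \<C> g" "tgt \<C> f = tgt \<C> g"
    and "\<i>\<d> \<I> \<boxtimes> f = \<i>\<d> \<I> \<boxtimes> g"
  shows "f = g"
proof -
  obtain v where "inverse_arrows \<C> (\<I> \<otimes> src \<C> f) (src \<C> f) (lunit \<C> (src \<C> f)) v"
    using lunit_iso assms(1) arr_obj by blast
  then show ?thesis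
    by (rule cancel_iso_right) (use assms lunit_nat[of f] lunit_nat[of g] in simp_all)
qed

text \<open>Kelly's coherence identity, from the pentagon at \<open>\<I>, \<I>, A, B\<close>.\<close>

lemma lunit_tensor:
  assumes A: "A \<in> Obj \<C>" and B: "B \<in> Obj \<C>"
  shows "lunit \<C> (A \<otimes> B) \<cdot> assc \<C> \<I> A B = lunit \<C> A \<boxtimes> \<i>\<d> B"
proof (rule unit_tensor_faithful)
  let ?i = "\<i>\<d> \<I>" and ?b = "\<i>\<d> B"
  \<comment> \<open>\<open>?u\<close> consists of the two factors of the pentagon at
    \<open>\<I>, \<I>, A, B\<close> that are applied first; being invertible, they may be
    precomposed to both sides and cancelled.\<close>
  let ?u = "assc \<C> \<I> (\<I> \<otimes> A) B \<cdot> (assc \<C> \<I> \<I> A \<boxtimes> ?b)"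
  let ?v = "(assc' \<C> \<I> \<I> A \<boxtimes> ?b) \<cdot> assc' \<C> \<I> (\<I> \<otimes> A) B"
  have iso: "inverse_arrows \<C> (((\<I> \<otimes> \<I>) \<otimes> A) \<otimes> B) (\<I> \<otimes> ((\<I> \<otimes> A) \<otimes> B)) ?u ?v"
    using A B by (simp add: inverse_arrows_def hom_def tensor_cmp tensor_cmp_cmp)
  show "?i \<boxtimes> (lunit \<C> (A \<otimes> B) \<cdot> assc \<C> \<I> A B) = ?i \<boxtimes> (lunit \<C> A \<boxtimes> ?b)"
  proof (rule cancel_iso_right[OF iso])
    have "(?i \<boxtimes> (lunit \<C> (A \<otimes> B) \<cdot> assc \<C> \<I> A B)) \<cdot> ?u
      = (?i \<boxtimes> lunit \<C> (A \<otimes> B)) \<cdot> (?i \<boxtimes> assc \<C> \<I> A B) \<cdot> ?u"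
      using A B by (simp add: tensor_cmp_cmp)
    also have "\<dots> = (?i \<boxtimes> lunit \<C> (A \<otimes> B)) \<cdot> assc \<C> \<I> \<I> (A \<otimes> B) \<cdot> assc \<C> (\<I> \<otimes> \<I>) A B"
      using A B by (simp add: pentagon)
    also have "\<dots> = ((?i \<boxtimes> lunit \<C> (A \<otimes> B)) \<cdot> assc \<C> \<I> \<I> (A \<otimes> B)) \<cdot> assc \<C> (\<I> \<otimes> \<I>) A B"
      using A B by simp
    \<comment> \<open>The triangle enters twice: here at \<open>\<I>\<close> and
      \<open>A \<otimes> B\<close> to remove the inner unit, and below at \<open>\<I>\<close> and
      \<open>A\<close> in the reverse direction to bring in \<open>lunit \<C> A\<close>. In between,
      \<open>\<i>\<d> A \<boxtimes> ?b\<close> must stay unfused so that naturality of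
      \<open>assc\<close> matches.\<close>
    also have "\<dots> = (runit \<C> \<I> \<boxtimes> (\<i>\<d> A \<boxtimes> ?b)) \<cdot> assc \<C> (\<I> \<otimes> \<I>) A B"
      using A B by (subst triangle) simp_all
    also have "\<dots> = assc \<C> \<I> A B \<cdot> ((runit \<C> \<I> \<boxtimes> \<i>\<d> A) \<boxtimes> ?b)"
      using A B by (simp add: assc_nat del: tensor_ident_simp)
    also have "\<dots> = assc \<C> \<I> A B \<cdot> ((?i \<boxtimes> lunit \<C> A) \<boxtimes> ?b) \<cdot> (assc \<C> \<I> \<I> A \<boxtimes> ?b)"
      using A B by (simp add: tensor_cmp triangle)
    also have "\<dots> = (?i \<boxtimes> (lunit \<C> A \<boxtimes> ?b)) \<cdot> ?u"
      using A B by (simp add: assc_nat_cmp)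
    finally show "(?i \<boxtimes> (lunit \<C> (A \<otimes> B) \<cdot> assc \<C> \<I> A B)) \<cdot> ?u = (?i \<boxtimes> (lunit \<C> A \<boxtimes> ?b)) \<cdot> ?u" .
  qed (use A B in simp_all)
qed (use A B in simp_all)

lemma lunit_tensor':
  assumes "A \<in> Obj \<C>" "B \<in> Obj \<C>"
  shows "(lunit \<C> A \<boxtimes> \<i>\<d> B) \<cdot> assc' \<C> \<I> A B = lunit \<C> (A \<otimes> B)"
  using assms by (simp flip: lunit_tensor)

text \<open>\<open>braid_unit\<close> concerns the braiding in the opposite direction; symmetry,
  that is \<open>braid\<close> being inverse to itself with its arguments exchanged, turns it
  around.\<close>

lemma runit_braid:
  assumes "A \<in> Obj \<C>"
  shows "runit \<C> A \<cdot> braid \<C> \<I> A = lunit \<C> A"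
proof -
  have "braid \<C> A \<I> \<cdot> braid \<C> \<I> A = \<i>\<d> (\<I> \<otimes> A)"
    using braid_iso[of \<I> A] assms by (simp add: inverse_arrows_def)
  then show ?thesis
    using assms by (simp flip: braid_unit)
qed

section \<open>Exchange of the two middle factors\<close>

lemma middle_swap_type [simp]:
  assumes "A \<in> Obj \<C>" "B \<in> Obj \<C>"
  shows "middle_swap \<C> A B \<in> Arr \<C>" "src \<C> (middle_swap \<C> A B) = (A \<otimes> A) \<otimes> (B \<otimes> B)"
    "tgt \<C> (middle_swap \<C> A B) = (A \<otimes> B) \<otimes> (A \<otimes> B)"
  using assms by (simp_all add: middle_swap_def)

text \<open>Each factor of \<open>middle_swap\<close> is natural, so \<open>f\<close> and
  \<open>g\<close> slide through one factor at a time. Only doubled arrows are treated, since these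
  are what copying produces.\<close>

lemma middle_swap_natural:
  assumes f: "f \<in> hom \<C> A A'" and g: "g \<in> hom \<C> B B'"
  shows "middle_swap \<C> A' B' \<cdot> ((f \<boxtimes> f) \<boxtimes> (g \<boxtimes> g)) = ((f \<boxtimes> g) \<boxtimes> (f \<boxtimes> g)) \<cdot> middle_swap \<C> A B"
proof -
  \<comment> \<open>The inner part of \<open>middle_swap\<close>, which moves \<open>A\<close> past
    the first of two copies of \<open>B\<close>; its naturality square is proved separately.\<close>
  define w where "w A B = assc \<C> B A B \<cdot> (braid \<C> A B \<boxtimes> \<i>\<d> B) \<cdot> assc' \<C> A B B" for A B
  note t = homD[OF f] homD[OF g]
  have o: "A \<in> Obj \<C>" "B \<in> Obj \<C>" "A' \<in> Obj \<C>" "B' \<in> Obj \<C>"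
    using t arr_obj by auto
  have wt: "w A B \<in> Arr \<C>" "src \<C> (w A B) = A \<otimes> (B \<otimes> B)" "tgt \<C> (w A B) = B \<otimes> (A \<otimes> B)"
    if "A \<in> Obj \<C>" "B \<in> Obj \<C>" for A B
    using that by (simp_all add: w_def)
  have w: "w A' B' \<cdot> (f \<boxtimes> (g \<boxtimes> g)) = (g \<boxtimes> (f \<boxtimes> g)) \<cdot> w A B"
  proof -
    have "w A' B' \<cdot> (f \<boxtimes> (g \<boxtimes> g))
      = assc \<C> B' A' B' \<cdot> (braid \<C> A' B' \<boxtimes> \<i>\<d> B') \<cdot> ((f \<boxtimes> g) \<boxtimes> g) \<cdot> assc' \<C> A B B"
      using t o by (simp add: w_def assc'_nat)
    also have "\<dots> = assc \<C> B' A' B' \<cdot> ((g \<boxtimes> f) \<boxtimes> g) \<cdot> (braid \<C> A B \<boxtimes> \<i>\<d> B) \<cdot> assc' \<C> A B B"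
      using t o by (simp add: tensor_cmp_cmp braid_nat)
    also have "\<dots> = (g \<boxtimes> (f \<boxtimes> g)) \<cdot> w A B"
      using t o by (simp add: w_def assc_nat_cmp)
    finally show ?thesis .
  qed
  have "middle_swap \<C> A' B' \<cdot> ((f \<boxtimes> f) \<boxtimes> (g \<boxtimes> g))
    = assc' \<C> A' B' (A' \<otimes> B') \<cdot> (\<i>\<d> A' \<boxtimes> w A' B') \<cdot> (f \<boxtimes> (f \<boxtimes> (g \<boxtimes> g))) \<cdot> assc \<C> A A (B \<otimes> B)"
    using t o wt by (simp add: middle_swap_def assc_nat flip: w_def)
  also have "\<dots> = assc' \<C> A' B' (A' \<otimes> B') \<cdot> (f \<boxtimes> (g \<boxtimes> (f \<boxtimes> g))) \<cdot> (\<i>\<d> A \<boxtimes> w A B) \<cdot> assc \<C> A A (B \<otimes> B)"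
    using t o wt w by (simp add: tensor_cmp_cmp)
  also have "\<dots> = ((f \<boxtimes> g) \<boxtimes> (f \<boxtimes> g)) \<cdot> middle_swap \<C> A B"
    using t o wt by (simp add: middle_swap_def assc'_nat_cmp flip: w_def)
  finally show ?thesis .
qed

text \<open>Exchanging a unit with its neighbour is invisible once the units are removed. This
  evaluates the exchange that remains after both copies of a program have been deleted.\<close>

lemma middle_swap_unit:
  assumes A: "A \<in> Obj \<C>"
  shows "(lunit \<C> A \<boxtimes> lunit \<C> A) \<cdot> middle_swap \<C> \<I> A = lunit \<C> (A \<otimes> A) \<cdot> (runit \<C> \<I> \<boxtimes> \<i>\<d> (A \<otimes> A))"
proof -
  let ?w = "assc \<C> A \<I> A \<cdot> (braid \<C> \<I> A \<boxtimes> \<i>\<d> A) \<cdot> assc' \<C> \<I> A A"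
  \<comment> \<open>Moving the unit past \<open>A\<close> and then removing it amounts to removing
    it at once: the triangle yields \<open>runit \<C> A\<close>, and \<open>runit_braid\<close>
    turns this into \<open>lunit \<C> A\<close>.\<close>
  have w: "(\<i>\<d> A \<boxtimes> lunit \<C> A) \<cdot> ?w = lunit \<C> (A \<otimes> A)"
  proof -
    have "(\<i>\<d> A \<boxtimes> lunit \<C> A) \<cdot> ?w
      = ((\<i>\<d> A \<boxtimes> lunit \<C> A) \<cdot> assc \<C> A \<I> A) \<cdot> (braid \<C> \<I> A \<boxtimes> \<i>\<d> A) \<cdot> assc' \<C> \<I> A A"
      using A by simp
    also have "\<dots> = (lunit \<C> A \<boxtimes> \<i>\<d> A) \<cdot> assc' \<C> \<I> A A"
      using A by (subst triangle) (simp_all add: tensor_cmp_cmp runit_braid)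
    finally show ?thesis using A by (simp add: lunit_tensor')
  qed
  let ?X = "(\<i>\<d> \<I> \<boxtimes> ?w) \<cdot> assc \<C> \<I> \<I> (A \<otimes> A)"
  \<comment> \<open>The two unitors are separated, with
    \<open>\<i>\<d> \<I> \<boxtimes> \<i>\<d> A\<close> left unfused, so that naturality of
    \<open>assc'\<close> can carry the second one inside, next to \<open>?w\<close>.\<close>
  have "(lunit \<C> A \<boxtimes> lunit \<C> A) \<cdot> middle_swap \<C> \<I> A
    = (lunit \<C> A \<boxtimes> \<i>\<d> A) \<cdot> ((\<i>\<d> \<I> \<boxtimes> \<i>\<d> A) \<boxtimes> lunit \<C> A) \<cdot> assc' \<C> \<I> A (\<I> \<otimes> A) \<cdot> ?X"
    using A by (simp add: middle_swap_def tensor_cmp_cmp)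
  also have "\<dots> = (lunit \<C> A \<boxtimes> \<i>\<d> A) \<cdot> assc' \<C> \<I> A A \<cdot> (\<i>\<d> \<I> \<boxtimes> (\<i>\<d> A \<boxtimes> lunit \<C> A)) \<cdot> ?X"
    using A by (simp add: assc'_nat_cmp del: tensor_ident_simp)
  also have "\<dots> = ((lunit \<C> A \<boxtimes> \<i>\<d> A) \<cdot> assc' \<C> \<I> A A) \<cdot> (\<i>\<d> \<I> \<boxtimes> ((\<i>\<d> A \<boxtimes> lunit \<C> A) \<cdot> ?w)) \<cdot> assc \<C> \<I> \<I> (A \<otimes> A)"
    using A by (simp add: tensor_cmp_cmp)
  also have "\<dots> = lunit \<C> (A \<otimes> A) \<cdot> (\<i>\<d> \<I> \<boxtimes> lunit \<C> (A \<otimes> A)) \<cdot> assc \<C> \<I> \<I> (A \<otimes> A)"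
    unfolding w using A by (simp only: lunit_tensor')
  also have "\<dots> = lunit \<C> (A \<otimes> A) \<cdot> (runit \<C> \<I> \<boxtimes> \<i>\<d> (A \<otimes> A))"
    using A by (simp add: triangle)
  finally show ?thesis .
qed

end

section \<open>Functional morphisms\<close>

context gs_monoidal_category
begin

lemma cpy_type [simp]:
  assumes "A \<in> Obj \<C>"
  shows "cpy \<C> A \<in> Arr \<C>" "src \<C> (cpy \<C> A) = A" "tgt \<C> (cpy \<C> A) = A \<otimes> A"
  using homD[OF cpy_hom[OF assms]] by auto

lemma del_type [simp]:
  assumes "A \<in> Obj \<C>"
  shows "del \<C> A \<in> Arr \<C>" "src \<C> (del \<C> A) = A" "tgt \<C> (del \<C> A) = \<I>"
  using homD[OF del_hom[OF assms]] by auto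

lemma functional_cmp:
  assumes "functional \<C> f" "functional \<C> g" "src \<C> g = tgt \<C> f"
  shows "functional \<C> (g \<cdot> f)"
proof -
  have t: "f \<in> Arr \<C>" "g \<in> Arr \<C>"
    and c: "cpy \<C> (tgt \<C> f) \<cdot> f = (f \<boxtimes> f) \<cdot> cpy \<C> (src \<C> f)"
      "cpy \<C> (tgt \<C> g) \<cdot> g = (g \<boxtimes> g) \<cdot> cpy \<C> (src \<C> g)"
    using assms by (auto simp: functional_def)
  have "cpy \<C> (tgt \<C> g) \<cdot> g \<cdot> f = (cpy \<C> (tgt \<C> g) \<cdot> g) \<cdot> f"
    using t assms(3) by simp
  also have "\<dots> = (g \<boxtimes> g) \<cdot> (f \<boxtimes> f) \<cdot> cpy \<C> (src \<C> f)"
    unfolding c(2) using t c(1) assms(3) by simp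
  also have "\<dots> = ((g \<cdot> f) \<boxtimes> (g \<cdot> f)) \<cdot> cpy \<C> (src \<C> f)"
    using t assms(3) by (simp add: tensor_cmp_cmp)
  finally show ?thesis
    using t assms(3) by (simp add: functional_def)
qed

text \<open>The projection \<pi> of the overview for arbitrary objects: it is applied with
  \<open>\<T>\<close> and with \<open>\<T> \<otimes> \<K>\<close> as the remaining factor.\<close>

definition discard_left :: "'o \<Rightarrow> 'o \<Rightarrow> 'm"
  where "discard_left A B = lunit \<C> B \<cdot> (del \<C> A \<boxtimes> \<i>\<d> B)"

lemma discard_left_type [simp]:
  assumes "A \<in> Obj \<C>" "B \<in> Obj \<C>"
  shows "discard_left A B \<in> Arr \<C>" "src \<C> (discard_left A B) = A \<otimes> B" "tgt \<C> (discard_left A B) = B"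
  using assms by (simp_all add: discard_left_def)

text \<open>Deleting the second copy first leaves the right counit law; naturality of
  \<open>runit\<close> moves the other deletion out of the way.\<close>

lemma runit_del_del_cpy:
  assumes A: "A \<in> Obj \<C>"
  shows "runit \<C> \<I> \<cdot> (del \<C> A \<boxtimes> del \<C> A) \<cdot> cpy \<C> A = del \<C> A"
proof -
  have "runit \<C> \<I> \<cdot> (del \<C> A \<boxtimes> del \<C> A) \<cdot> cpy \<C> A
    = (runit \<C> \<I> \<cdot> (del \<C> A \<boxtimes> \<i>\<d> \<I>)) \<cdot> (\<i>\<d> A \<boxtimes> del \<C> A) \<cdot> cpy \<C> A"
    using A by (simp add: tensor_cmp_cmp)
  also have "\<dots> = del \<C> A \<cdot> runit \<C> A \<cdot> (\<i>\<d> A \<boxtimes> del \<C> A) \<cdot> cpy \<C> A"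
    using A runit_nat[of "del \<C> A"] by simp
  also have "\<dots> = del \<C> A"
    using A by (simp add: cpy_counit_right)
  finally show ?thesis .
qed

text \<open>Copying a pair copies each component and exchanges the middle factors. Both projections
  slide through the exchange, leaving one with units; the two deletions of \<open>A\<close> collapse
  into one by the counit law, and naturality of \<open>lunit\<close> extracts the copy of
  \<open>B\<close>.\<close>

lemma functional_discard_left:
  assumes A: "A \<in> Obj \<C>" and B: "B \<in> Obj \<C>"
  shows "functional \<C> (discard_left A B)"
proof -
  let ?d = "del \<C> A" and ?b = "\<i>\<d> B"
  have "(discard_left A B \<boxtimes> discard_left A B) \<cdot> cpy \<C> (A \<otimes> B)
    = (lunit \<C> B \<boxtimes> lunit \<C> B) \<cdot> (((?d \<boxtimes> ?b) \<boxtimes> (?d \<boxtimes> ?b)) \<cdot> middle_swap \<C> A B) \<cdot> (cpy \<C> A \<boxtimes> cpy \<C> B)"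
    using A B by (simp add: discard_left_def cpy_tensor tensor_cmp_cmp)
  \<comment> \<open>Naturality of the exchange at the deletion \<open>A \<rightarrow> \<I>\<close>
    and the identity of \<open>B\<close>.\<close>
  also have "\<dots> = (lunit \<C> B \<boxtimes> lunit \<C> B) \<cdot> (middle_swap \<C> \<I> B \<cdot> ((?d \<boxtimes> ?d) \<boxtimes> (?b \<boxtimes> ?b))) \<cdot> (cpy \<C> A \<boxtimes> cpy \<C> B)"
    using middle_swap_natural[OF del_hom ident_hom] A B by metis
  also have "\<dots> = ((lunit \<C> B \<boxtimes> lunit \<C> B) \<cdot> middle_swap \<C> \<I> B) \<cdot> (((?d \<boxtimes> ?d) \<cdot> cpy \<C> A) \<boxtimes> cpy \<C> B)"
    using A B by (simp add: tensor_cmp)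
  also have "\<dots> = lunit \<C> (B \<otimes> B) \<cdot> (?d \<boxtimes> cpy \<C> B)"
    unfolding middle_swap_unit[OF B] using A B by (simp add: tensor_cmp runit_del_del_cpy)
  also have "\<dots> = (lunit \<C> (B \<otimes> B) \<cdot> (\<i>\<d> \<I> \<boxtimes> cpy \<C> B)) \<cdot> (?d \<boxtimes> ?b)"
    using A B by (simp add: tensor_cmp)
  also have "\<dots> = cpy \<C> B \<cdot> discard_left A B"
    using A B lunit_nat[of "cpy \<C> B"] by (simp add: discard_left_def)
  finally show ?thesis
    using A B by (simp add: functional_def)
qed

text \<open>The deletion hits only the untouched copy of the input, so after sliding
  \<open>f\<close> past \<open>lunit\<close> the left counit law finishes; \<open>f\<close> may be
  an arbitrary arrow.\<close>

lemma discard_left_cpy: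
  assumes f: "f \<in> hom \<C> A B"
  shows "discard_left A B \<cdot> (\<i>\<d> A \<boxtimes> f) \<cdot> cpy \<C> A = f"
proof -
  note t = homD[OF f]
  have o: "A \<in> Obj \<C>" "B \<in> Obj \<C>"
    using t arr_obj by auto
  have "discard_left A B \<cdot> (\<i>\<d> A \<boxtimes> f) \<cdot> cpy \<C> A
    = (lunit \<C> B \<cdot> (\<i>\<d> \<I> \<boxtimes> f)) \<cdot> (del \<C> A \<boxtimes> \<i>\<d> A) \<cdot> cpy \<C> A"
    using t o by (simp add: discard_left_def tensor_cmp_cmp)
  also have "\<dots> = f \<cdot> lunit \<C> A \<cdot> (del \<C> A \<boxtimes> \<i>\<d> A) \<cdot> cpy \<C> A"
    using t o lunit_nat[of f] by simp
  also have "\<dots> = f"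
    using t o by (simp add: cpy_counit_left)
  finally show ?thesis .
qed

text \<open>Links the two bracketings: \<open>processing\<close> compares \<open>q\<close> with a
  deletion on \<open>A \<otimes> (B \<otimes> D)\<close>, whereas precomposition produces a
  projection tensored with an identity. The link is Kelly's identity
  \<open>lunit_tensor\<close>.\<close>

lemma discard_left_tensor:
  assumes "A \<in> Obj \<C>" "B \<in> Obj \<C>" "D \<in> Obj \<C>"
  shows "discard_left A (B \<otimes> D) \<cdot> assc \<C> A B D = discard_left A B \<boxtimes> \<i>\<d> D"
proof -
  have "discard_left A (B \<otimes> D) \<cdot> assc \<C> A B D
    = lunit \<C> (B \<otimes> D) \<cdot> (del \<C> A \<boxtimes> (\<i>\<d> B \<boxtimes> \<i>\<d> D)) \<cdot> assc \<C> A B D"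
    using assms by (simp add: discard_left_def)
  also have "\<dots> = lunit \<C> (B \<otimes> D) \<cdot> assc \<C> \<I> B D \<cdot> ((del \<C> A \<boxtimes> \<i>\<d> B) \<boxtimes> \<i>\<d> D)"
    using assms by (simp add: assc_nat del: tensor_ident_simp)
  also have "\<dots> = (lunit \<C> (B \<otimes> D) \<cdot> assc \<C> \<I> B D) \<cdot> ((del \<C> A \<boxtimes> \<i>\<d> B) \<boxtimes> \<i>\<d> D)"
    using assms by simp
  also have "\<dots> = discard_left A B \<boxtimes> \<i>\<d> D"
    using assms by (subst lunit_tensor) (simp_all add: discard_left_def tensor_cmp)
  finally show ?thesis .
qed

end

section \<open>Simulators\<close>

context target_context_category
begin

lemma distinguished_obj [simp]: "\<T> \<in> Obj \<C>" "\<K> \<in> Obj \<C>"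
  by (rule target_obj context_obj_obj)+

lemma simulatorD:
  assumes "simulator \<C> P s"
  shows "P \<in> Obj \<C>" "s \<in> Arr \<C>" "src \<C> s = P \<otimes> \<K>" "tgt \<C> s = \<T> \<otimes> \<K>"
  using assms by (auto simp: simulator_def hom_def)

section \<open>Pulling simulators back along maps of programs\<close>

lemma pull_cmp:
  assumes "simulator \<C> P s" "f \<in> Arr \<C>" "g \<in> Arr \<C>" "tgt \<C> g = P" "src \<C> g = tgt \<C> f"
  shows "pull \<C> f (pull \<C> g s) = pull \<C> (g \<cdot> f) s"
  using simulatorD[OF assms(1)] assms(2-5) by (simp add: pull_def tensor_cmp)

text \<open>Functionality lets \<open>f\<close> pass through the copy of the program, one instance
  going to the compiler, now \<open>sT \<cdot> f\<close>, and one to the context reduction, now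
  \<open>sC \<cdot> (f \<boxtimes> \<i>\<d> \<K>)\<close>. It is used both for the reduction along
  \<open>m\<close> and for the processing \<open>q\<close>.\<close>

lemma simulator_pull:
  assumes s: "simulator \<C> P s" and f: "functional \<C> f" and fPQ: "f \<in> hom \<C> Q P"
  shows "simulator \<C> Q (pull \<C> f s)"
proof -
  obtain sT sC where sT: "sT \<in> hom \<C> P \<T>" "functional \<C> sT" and sC: "sC \<in> hom \<C> (P \<otimes> \<K>) \<K>"
    and s_eq: "s = (sT \<boxtimes> sC) \<cdot> assc \<C> P P \<K> \<cdot> (cpy \<C> P \<boxtimes> \<i>\<d> \<K>)"
    using s by (auto simp: simulator_def)
  note t = homD[OF fPQ] homD[OF sT(1)] homD[OF sC] simulatorD[OF s]
  have Q: "Q \<in> Obj \<C>"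
    using t(1,2) arr_obj by auto
  have c: "cpy \<C> P \<cdot> f = (f \<boxtimes> f) \<cdot> cpy \<C> Q"
    using f t by (simp add: functional_def)
  have "pull \<C> f s = (sT \<boxtimes> sC) \<cdot> assc \<C> P P \<K> \<cdot> ((cpy \<C> P \<cdot> f) \<boxtimes> \<i>\<d> \<K>)"
    unfolding pull_def s_eq using t Q by (simp add: tensor_cmp)
  also have "\<dots> = (sT \<boxtimes> sC) \<cdot> assc \<C> P P \<K> \<cdot> ((f \<boxtimes> f) \<boxtimes> \<i>\<d> \<K>) \<cdot> (cpy \<C> Q \<boxtimes> \<i>\<d> \<K>)"
    unfolding c using t Q by (simp add: tensor_cmp)
  also have "\<dots> = ((sT \<cdot> f) \<boxtimes> (sC \<cdot> (f \<boxtimes> \<i>\<d> \<K>))) \<cdot> assc \<C> Q Q \<K> \<cdot> (cpy \<C> Q \<boxtimes> \<i>\<d> \<K>)"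
    using t Q by (simp add: assc_nat_cmp tensor_cmp_cmp)
  finally have eq: "pull \<C> f s = \<dots>" .
  have "sT \<cdot> f \<in> hom \<C> Q \<T>" "sC \<cdot> (f \<boxtimes> \<i>\<d> \<K>) \<in> hom \<C> (Q \<otimes> \<K>) \<K>"
    using t by (auto intro!: homI)
  moreover have "pull \<C> f s \<in> hom \<C> (Q \<otimes> \<K>) (\<T> \<otimes> \<K>)"
    using t by (auto intro!: homI simp: pull_def)
  moreover have "functional \<C> (sT \<cdot> f)"
    using functional_cmp[OF f sT(2)] t by simp
  ultimately show ?thesis
    using Q eq unfolding simulator_def by blast
qed

lemma pull_trivial_simulator:
  assumes "f \<in> hom \<C> P \<T>"
  shows "pull \<C> f (trivial_simulator \<C>) = f \<boxtimes> \<i>\<d> \<K>"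
  using homD[OF assms] by (simp add: pull_def trivial_simulator_def)

lemma ambient_pull:
  assumes s: "simulator \<C> P s" and s': "simulator \<C> P s'" and f: "f \<in> hom \<C> Q P"
    and "s \<succeq> s'"
  shows "pull \<C> f s \<succeq> pull \<C> f s'"
  unfolding pull_def
  by (rule ambient_precomp[of _ "P \<otimes> \<K>" _ _ "Q \<otimes> \<K>"])
    (use assms simulatorD[OF s] simulatorD[OF s'] homD[OF f] in \<open>auto intro: homI\<close>)

section \<open>The morphism from the trivial simulator\<close>

lemma more_parsimonious_than_trivial:
  assumes s: "simulator \<C> P s"
    and oplax: "oplax_reduction \<C> P s \<T> (trivial_simulator \<C>) r"
    and m: "m \<in> hom \<C> P \<T>" "functional \<C> m"
    and sm: "pull \<C> (r \<cdot> m) s = s"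
  shows "more_parsimonious \<C> P s \<T> (trivial_simulator \<C>)"
proof -
  let ?\<pi> = "discard_left P \<T>"
  define q where "q = pull \<C> (r \<cdot> ?\<pi>) s"
  have triv: "simulator \<C> \<T> (trivial_simulator \<C>)" and r: "r \<in> hom \<C> \<T> P" "functional \<C> r"
    and ge: "trivial_simulator \<C> \<succeq> pull \<C> r s"
    using oplax by (auto simp: oplax_reduction_def)
  note t = homD[OF m(1)] homD[OF r(1)] simulatorD[OF s]
  have \<pi>: "?\<pi> \<in> hom \<C> (P \<otimes> \<T>) \<T>"
    using t by (auto intro!: homI)
  \<comment> \<open>Functionality of \<open>m\<close> makes the intermediate object of the morphism
    a simulator.\<close>
  have red: "simulator \<C> P (pull \<C> m (trivial_simulator \<C>))"
    by (rule simulator_pull[OF triv m(2,1)])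
  have q_sim: "simulator \<C> (P \<otimes> \<T>) q"
    unfolding q_def
  proof (rule simulator_pull[OF s])
    show "functional \<C> (r \<cdot> ?\<pi>)"
      using functional_cmp[OF functional_discard_left r(2)] t by simp
    show "r \<cdot> ?\<pi> \<in> hom \<C> (P \<otimes> \<T>) P"
      using t by (auto intro!: homI)
  qed
  have "pull \<C> ?\<pi> (trivial_simulator \<C>) \<succeq> pull \<C> ?\<pi> (pull \<C> r s)"
    by (rule ambient_pull[OF triv simulator_pull[OF s r(2,1)] \<pi> ge])
  also have "pull \<C> ?\<pi> (pull \<C> r s) = q"
    unfolding q_def using t by (intro pull_cmp[OF s]) simp_all
  \<comment> \<open>Rebracketing brings the upper bound into the shape demanded by
    \<open>processing\<close>.\<close>
  also have "pull \<C> ?\<pi> (trivial_simulator \<C>) = discard_left P (\<T> \<otimes> \<K>) \<cdot> assc \<C> P \<T> \<K>"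
    using t by (simp add: pull_trivial_simulator[OF \<pi>] discard_left_tensor)
  finally have q_le: "lunit \<C> (\<T> \<otimes> \<K>) \<cdot> (del \<C> P \<boxtimes> \<i>\<d> (\<T> \<otimes> \<K>)) \<cdot> assc \<C> P \<T> \<K> \<succeq> q"
    using t by (simp add: discard_left_def)
  \<comment> \<open>Naturality carries \<open>assc'\<close> past \<open>m\<close>, where it cancels
    \<open>assc \<C> P P \<K>\<close>; the context is then untouched and everything takes place on
    programs.\<close>
  have "q \<cdot> assc' \<C> P \<T> \<K> \<cdot> (\<i>\<d> P \<boxtimes> (m \<boxtimes> \<i>\<d> \<K>)) \<cdot> assc \<C> P P \<K> \<cdot> (cpy \<C> P \<boxtimes> \<i>\<d> \<K>)
    = q \<cdot> ((\<i>\<d> P \<boxtimes> m) \<boxtimes> \<i>\<d> \<K>) \<cdot> (cpy \<C> P \<boxtimes> \<i>\<d> \<K>)"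
    using t by (simp add: assc'_nat_cmp)
  also have "\<dots> = s \<cdot> ((r \<cdot> ?\<pi> \<cdot> (\<i>\<d> P \<boxtimes> m) \<cdot> cpy \<C> P) \<boxtimes> \<i>\<d> \<K>)"
    using t by (simp add: q_def pull_def tensor_cmp)
  also have "\<dots> = s"
    using sm by (simp add: discard_left_cpy[OF m(1)] pull_def)
  finally have q_eq: "s = q \<cdot> assc' \<C> P \<T> \<K> \<cdot> (\<i>\<d> P \<boxtimes> pull \<C> m (trivial_simulator \<C>)) \<cdot>
      assc \<C> P P \<K> \<cdot> (cpy \<C> P \<boxtimes> \<i>\<d> \<K>)"
    by (simp add: pull_trivial_simulator[OF m(1)])
  \<comment> \<open>The reduction is given by \<open>m\<close>; the arrow \<open>r\<close> enters
    the morphism only through \<open>q\<close>.\<close>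
  have "simulator_morphism \<C> \<T> (trivial_simulator \<C>) P s m q"
    unfolding simulator_morphism_def reduction_def processing_def
    using triv red s q_sim q_le q_eq m by blast
  then show ?thesis
    unfolding more_parsimonious_def by blast
qed

end

text \<open>Functionality of \<open>m\<close> is assumed because \<open>m\<close> has to define a
  reduction; the relational example among the definitions shows how the conclusion fails
  otherwise.\<close>

theorem mainTheorem2:
  fixes \<C> :: "('o, 'm, 'z) target_context_data_scheme" (structure)
  assumes "target_context_category \<C>"
    and "simulator \<C> P s"
    and "lax_reduction \<C> P s \<T> (trivial_simulator \<C>) r"
    and "oplax_reduction \<C> P s \<T> (trivial_simulator \<C>) r"
    and "m \<in> hom \<C> P \<T>"
    and "functional \<C> m"
    and "s \<cdot> ((r \<cdot> m) \<boxtimes> \<i>\<d> \<K>) = s"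
  shows "more_parsimonious \<C> P s \<T> (trivial_simulator \<C>)"
proof (rule target_context_category.more_parsimonious_than_trivial[OF assms(1,2,4-6)])
  show "pull \<C> (r \<cdot> m) s = s"
    using assms(7) by (simp add: pull_def)
qed

end
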